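(* Let $b \ge 2$ be an integer, let $r \in \{0, 1, \dots, b-1\}$ and let $i \ge 1$ be an integer, all fixed. Then, as $T \to +\infty$, \[ \Phi(T; b, r; i) = c(b, r; i)\, T^2 + O\bigl(T \log(T)\bigr), \] where the implicit constant may depend on $b$, $r$ and $i$.
   Context: For a positive real number $x$, an integer $b \ge 2$ and a positive integer $i$, let $\phi(x; b; i)$ be the $i$-th digit to the right of the point in the representation of $x$ in base $b$, i.e. \[ \phi(x; b; i) = \bigl\lfloor b \{ b^{i-1} x \} \bigr\rfloor , \] where $\lfloor \cdot \rfloor$ and $\{\cdot\}$ denote the integer part and the fractional part. For $r \in \{0, \dots, b-1\}$ and real $T \ge 1$ put \[ \mathcal{A}(T; b, r; i) = \{ (n, m) \in \mathbb{N}^2 \cap [1, T]^2 : \phi(n/m; b; i) = r \}, \qquad \Phi(T; b, r; i) = \vert \mathcal{A}(T; b, r; i) \vert . \] The constant $c(b, r; i)$ is \[ c(b, r; i) = \frac{1}{2b} + \frac12 b^i \int_0^1 \frac{1 - \varphi}{1 - \varphi^b}\, \varphi^{b^i + r - 1} \, \mathrm{d}\varphi = \frac{1}{2b} + \frac12 b^{i-1} \Bigl( \psi\Bigl( \frac{b^i + r + 1}{b} \Bigr) - \psi\Bigl( \frac{b^i + r}{b} \Bigr) \Bigr), \] where $\psi = \Gamma'/\Gamma$ is the digamma function. *)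

theory Defs
  imports "HOL-Analysis.Analysis" "HOL-Library.Landau_Symbols"
begin

text \<open>Digit positions are counted from \<open>1\<close>: \<open>i = 1\<close> is the first digit after the point.\<close>

definition base_digit :: "real \<Rightarrow> nat \<Rightarrow> nat \<Rightarrow> int"
  where "base_digit x b i = \<lfloor>real b * frac (real b ^ (i - 1) * x)\<rfloor>"

definition digit_pairs :: "real \<Rightarrow> nat \<Rightarrow> nat \<Rightarrow> nat \<Rightarrow> (nat \<times> nat) set"
  where "digit_pairs T b r i =
    {(n, m). 1 \<le> real n \<and> real n \<le> T \<and> 1 \<le> real m \<and> real m \<le> T \<and>
             base_digit (real n / real m) b i = int r}"

definition digit_count :: "real \<Rightarrow> nat \<Rightarrow> nat \<Rightarrow> nat \<Rightarrow> nat"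
  where "digit_count T b r i = card (digit_pairs T b r i)"

text \<open>
  At \<open>t = 1\<close> the integrand is \<open>0 / 0 = 0\<close>; a single point does not affect the integral.
\<close>

definition digit_const :: "nat \<Rightarrow> nat \<Rightarrow> nat \<Rightarrow> real"
  where "digit_const b r i = 1 / (2 * real b) + 1 / 2 * real b ^ i *
    integral {0..1} (\<lambda>t::real. (1 - t) / (1 - t ^ b) * t ^ (b ^ i + r - 1))"

lemma finite_digit_pairs: "finite (digit_pairs T b r i)"
proof (rule finite_subset)
  show "digit_pairs T b r i \<subseteq> {..nat \<lfloor>T\<rfloor>} \<times> {..nat \<lfloor>T\<rfloor>}"
    by (auto simp: digit_pairs_def le_nat_floor)
qed auto

lemma has_integral_digit_const:
  fixes b s :: nat
  assumes b: "b \<ge> 2" and s: "s \<ge> 1"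
  shows "((\<lambda>t::real. (1 - t) / (1 - t ^ b) * t ^ (s - 1)) has_integral
           (Digamma (real (s + 1) / real b) - Digamma (real s / real b)) / real b) {0..1}"
proof -
  define g where "g = (\<lambda>t::real. (1 - t) / (1 - t ^ b) * t ^ (s - 1))"
  define f where "f = (\<lambda>k (t::real). \<Sum>j<k. (1 - t) * t ^ (b * j + s - 1))"
  define D where "D = Digamma (real (s + 1) / real b) - Digamma (real s / real b)"
  define S where "S = (\<lambda>k. \<Sum>j<k. 1 / real (b * j + s) - 1 / real (b * j + s + 1))"
  have trm: "((\<lambda>t::real. (1 - t) * t ^ (b * j + s - 1)) has_integral
      (1 / real (b * j + s) - 1 / real (b * j + s + 1))) {0..1}" for j
  proof -
    define n where "n = b * j + s - 1"
    have n: "b * j + s = Suc n" using s by (simp add: n_def)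
    have pow: "((\<lambda>t::real. t ^ k) has_integral 1 / real (Suc k)) {0..1}" for k
    proof -
      have "((\<lambda>t::real. t ^ k) has_integral 1 ^ Suc k / real (Suc k) - 0 ^ Suc k / real (Suc k)) {0..1}"
      proof (rule fundamental_theorem_of_calculus)
        fix t :: real
        have "((\<lambda>t. t ^ Suc k / real (Suc k)) has_real_derivative t ^ k) (at t within {0..1})"
          by (rule DERIV_cdivide[OF DERIV_pow, THEN DERIV_cong])
             (simp del: of_nat_Suc power_Suc)
        then show "((\<lambda>t. t ^ Suc k / real (Suc k)) has_vector_derivative t ^ k) (at t within {0..1})"
          by (simp only: has_real_derivative_iff_has_vector_derivative)
      qed simp
      then show ?thesis by simp
    qed
    have "((\<lambda>t::real. (1 - t) * t ^ n) has_integral 1 / real (Suc n) - 1 / real (Suc (Suc n))) {0..1}"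
      using has_integral_diff[OF pow[of n] pow[of "Suc n"]] by (simp add: algebra_simps)
    then show ?thesis unfolding n by simp
  qed
  have f_int: "(f k has_integral S k) {0..1}" for k
    unfolding f_def S_def by (intro has_integral_sum trm) auto
  have S_lim: "S \<longlonglongrightarrow> D / real b"
  proof -
    let ?L = "\<lambda>z m. of_real (ln (real m)) - (\<Sum>n<m. inverse (z + of_nat n)) :: real"
    have "(\<lambda>m. (?L (real (s + 1) / real b) m - ?L (real s / real b) m) / real b) \<longlonglongrightarrow> D / real b"
      unfolding D_def using b s by (intro tendsto_intros Digamma_LIMSEQ) auto
    moreover have "(?L (real (s + 1) / real b) m - ?L (real s / real b) m) / real b = S m" for m
    proof -
      have *: "inverse (real u / real b + real j) / real b = 1 / real (b * j + u)" for u j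
      proof -
        have "real u / real b + real j = real (b * j + u) / real b"
          using b by (simp add: add_divide_distrib)
        then show ?thesis using b by simp
      qed
      have "(?L (real (s + 1) / real b) m - ?L (real s / real b) m) / real b =
         (\<Sum>n<m. inverse (real s / real b + real n) / real b)
         - (\<Sum>n<m. inverse (real (s + 1) / real b + real n) / real b)"
        by (simp add: diff_divide_distrib sum_divide_distrib)
      also have "\<dots> = S m"
        unfolding * S_def by (simp add: sum_subtractf add.assoc)
      finally show ?thesis .
    qed
    ultimately show ?thesis by simp
  qed
  have f_lim: "(\<lambda>k. f k t) \<longlonglongrightarrow> g t" if t: "t \<in> {0..1}" for t
  proof (cases "t = 1")
    case True
    then show ?thesis by (simp add: f_def g_def)
  next
    case False
    with t b have tb: "norm (t ^ b) < 1" by (simp add: power_less_one_iff)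
    have "(\<lambda>j. (1 - t) * t ^ (s - 1) * (t ^ b) ^ j) sums ((1 - t) * t ^ (s - 1) * (1 / (1 - t ^ b)))"
      by (intro sums_mult geometric_sums tb)
    moreover have "(1 - t) * t ^ (s - 1) * (t ^ b) ^ j = (1 - t) * t ^ (b * j + s - 1)" for j
      using s by (simp flip: power_mult power_add add: add.commute)
    ultimately have "(\<lambda>j. (1 - t) * t ^ (b * j + s - 1)) sums ((1 - t) * t ^ (s - 1) * (1 / (1 - t ^ b)))"
      by (simp only:)
    then show ?thesis by (simp add: sums_def f_def g_def)
  qed
  have "(g has_integral D / real b) {0..1}"
  proof (rule has_integral_monotone_convergence_increasing)
    show "(f k has_integral S k) {0..1}" for k by (rule f_int)
    show "f k t \<le> f (Suc k) t" if "t \<in> {0..1}" for k t using that by (simp add: f_def)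
    show "(\<lambda>k. f k t) \<longlonglongrightarrow> g t" if "t \<in> {0..1}" for t using f_lim that .
    show "S \<longlonglongrightarrow> D / real b" by (rule S_lim)
  qed
  then show ?thesis unfolding g_def D_def .
qed

lemma digit_const_Digamma:
  assumes b: "b \<ge> 2" and i: "i \<ge> 1"
  shows "digit_const b r i = 1 / (2 * real b) + 1 / 2 * real b ^ (i - 1) *
    (Digamma ((real b ^ i + real r + 1) / real b) - Digamma ((real b ^ i + real r) / real b))"
proof -
  have "b ^ i + r \<ge> 1" using b by (simp add: Suc_leI)
  from integral_unique[OF has_integral_digit_const[OF b this]]
  show ?thesis using b i
    by (cases i) (auto simp: digit_const_def add_ac)
qed

end

theory Submission
  imports Defs
begin

text \<open>
  Put \<open>Q = b ^ i\<close> and \<open>N = \<lfloor>T\<rfloor>\<close>. The digit of \<open>n / m\<close> is \<open>r\<close> iff \<open>Q n / m\<close> lies in some interval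
  \<open>[b k + r, b k + r + 1)\<close>. For fixed \<open>m\<close> only \<open>O(Q N / m + 1)\<close> of these intervals meet \<open>n \<le> N\<close>, and on
  each the number of \<open>n\<close> differs from the length by at most \<open>1\<close>; summing over \<open>m\<close> costs \<open>O(N log N)\<close>.
  The total length \<open>h m\<close> extends to real arguments with local Lipschitz constant \<open>2 N / m\<close>, so replacing
  the sum of \<open>h m\<close> by the integral of \<open>h\<close> also costs \<open>O(N log N)\<close>. The integral is \<open>N\<^sup>2\<close> times a series of
  areas of triangles, whose value is the constant. All bounds are uniform in the number of intervals
  \<open>k < K\<close>, so the series may be truncated and the limit \<open>K \<rightarrow> \<infinity>\<close> taken at the end.
\<close>

section \<open>Lipschitz bounds for the total interval length\<close>

text \<open>The sum is the length of the part of the successive intervals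
  \<open>[\<alpha> k, \<beta> k]\<close> below \<open>x\<close>. They overlap at most in endpoints,
  so raising \<open>x\<close> to \<open>y\<close> adds between \<open>0\<close> and
  \<open>y - x\<close>.\<close>

lemma sum_min_diff_lipschitz:
  fixes \<alpha> \<beta> :: "nat \<Rightarrow> real" and K :: nat
  assumes ab: "\<And>k. \<alpha> k \<le> \<beta> k" and ba: "\<And>k. \<beta> k \<le> \<alpha> (Suc k)" and xy: "x \<le> y"
  shows "(\<Sum>k<K. min x (\<beta> k) - min x (\<alpha> k)) \<le> (\<Sum>k<K. min y (\<beta> k) - min y (\<alpha> k))" (is ?mono)
    and "(\<Sum>k<K. min y (\<beta> k) - min y (\<alpha> k)) - (\<Sum>k<K. min x (\<beta> k) - min x (\<alpha> k)) \<le> y - x" (is ?lip)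
proof -
  \<comment> \<open>\<open>\<delta> c\<close> is the length of the part of \<open>[x, y]\<close>
    below \<open>c\<close>: nondecreasing in \<open>c\<close>, with values between \<open>0\<close>
    and \<open>y - x\<close>.\<close>
  define \<delta> where "\<delta> = (\<lambda>c. min y c - min x c)"
  have mono: "\<delta> c \<le> \<delta> d" if "c \<le> d" for c d
    using that xy by (auto simp: \<delta>_def min_def)
  have eq: "(\<Sum>k<K. min y (\<beta> k) - min y (\<alpha> k)) - (\<Sum>k<K. min x (\<beta> k) - min x (\<alpha> k))
      = (\<Sum>k<K. \<delta> (\<beta> k) - \<delta> (\<alpha> k))"
    by (simp add: \<delta>_def sum_subtractf[symmetric] algebra_simps)
  have "(\<Sum>k<K. \<delta> (\<beta> k) - \<delta> (\<alpha> k)) \<ge> 0"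
    by (intro sum_nonneg) (simp add: mono ab)
  with eq show ?mono by simp
  \<comment> \<open>Telescoping: the omitted increments over the gaps from \<open>\<beta> k\<close>
    to \<open>\<alpha> (Suc k)\<close> are nonnegative.\<close>
  have "(\<Sum>k<K. \<delta> (\<beta> k) - \<delta> (\<alpha> k)) \<le> \<delta> (\<alpha> K)"
  proof (induction K)
    case 0
    then show ?case using xy by (simp add: \<delta>_def)
  next
    case (Suc K)
    then show ?case using mono[OF ba[of K]] by simp
  qed
  also have "\<dots> \<le> y - x" using xy by (auto simp: \<delta>_def min_def)
  finally show ?lip using eq by simp
qed

text \<open>
  By homogeneity the sum equals \<open>t\<close> times its value with \<open>t = 1\<close> and \<open>N / t\<close> in place of \<open>N\<close>,
  so \<open>sum_min_diff_lipschitz\<close> applies.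
\<close>

lemma sum_min_scaled_diff_bound:
  fixes \<alpha> \<beta> :: "nat \<Rightarrow> real" and K :: nat
  assumes ab: "\<And>k. \<alpha> k \<le> \<beta> k" and ba: "\<And>k. \<beta> k \<le> \<alpha> (Suc k)" and a0: "\<And>k. 0 \<le> \<alpha> k"
    and N: "0 \<le> N" and s: "0 \<le> s" "s \<le> t" "0 < t"
  defines "h \<equiv> \<lambda>t. \<Sum>k<K. min N (\<beta> k * t) - min N (\<alpha> k * t)"
  shows "\<bar>h t - h s\<bar> \<le> 2 * N / t * (t - s)"
proof -
  define g where "g = (\<lambda>y. \<Sum>k<K. min y (\<beta> k) - min y (\<alpha> k))"
  have b0: "0 \<le> \<beta> k" for k using ab[of k] a0[of k] by linarith
  have h_eq: "h u = u * g (N / u)" if "u > 0" for u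
    unfolding h_def g_def using that
    by (simp add: sum_distrib_left right_diff_distrib min_mult_distrib_left mult.commute)
  have lip: "g x \<le> g y" "g y - g x \<le> y - x" if "x \<le> y" for x y
    unfolding g_def using sum_min_diff_lipschitz[of \<alpha> \<beta>, OF ab ba that] by auto
  have g0: "g 0 = 0" unfolding g_def using a0 b0 by simp
  have g_bd: "0 \<le> g y" "g y \<le> y" if "0 \<le> y" for y
    using lip[OF that] g0 by auto
  show ?thesis
  proof (cases "s = 0")
    \<comment> \<open>\<open>h_eq\<close> needs a positive argument; at \<open>s = 0\<close> the
      bounds \<open>0 \<le> h t \<le> N\<close> suffice.\<close>
    case True
    have "h s = 0" unfolding h_def using True N by simp
    moreover have "0 \<le> h t" "h t \<le> N"
      using g_bd[of "N / t"] N s by (simp_all add: h_eq pos_le_divide_eq mult.commute)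
    ultimately show ?thesis using True N s by simp
  next
    case False
    with s have s0: "s > 0" by simp
    have le: "N / t \<le> N / s" using s s0 N by (intro divide_left_mono) auto
    \<comment> \<open>Both terms on the right lie between \<open>0\<close> and
      \<open>(t - s) * (N / t)\<close>.\<close>
    have "h t - h s = (t - s) * g (N / t) - s * (g (N / s) - g (N / t))"
      using s s0 by (simp add: h_eq algebra_simps)
    moreover have "0 \<le> (t - s) * g (N / t)" "(t - s) * g (N / t) \<le> (t - s) * (N / t)"
      using g_bd[of "N / t"] N s by (auto intro!: mult_left_mono simp del: times_divide_eq_right)
    moreover have "0 \<le> s * (g (N / s) - g (N / t))"
      using lip[OF le] s0 by simp
    moreover have "s * (g (N / s) - g (N / t)) \<le> s * (N / s - N / t)"
      using lip[OF le] s0 by (intro mult_left_mono) auto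
    moreover have "s * (N / s - N / t) = (t - s) * (N / t)"
      using s s0 by (simp add: field_simps)
    moreover have "0 \<le> (t - s) * (N / t)" using s N by simp
    ultimately have "\<bar>h t - h s\<bar> \<le> 2 * ((t - s) * (N / t))" by linarith
    then show ?thesis by (simp add: ac_simps)
  qed
qed

section \<open>From the sum over \<open>m\<close> to an integral\<close>

text \<open>Each value is compared with the integral over the unit interval to its left. Taking the
  right endpoint keeps the error \<open>C / (m + 1)\<close> finite on \<open>[0, 1]\<close>
  too.\<close>

lemma sum_integral_harm_bound:
  fixes f :: "real \<Rightarrow> real"
  assumes cont: "continuous_on UNIV f"
    and bd: "\<And>m t. t \<in> {real m..real (Suc m)} \<Longrightarrow> \<bar>f (real (Suc m)) - f t\<bar> \<le> C / real (Suc m)"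
  shows "\<bar>(\<Sum>m=1..M. f (real m)) - integral {0..real M} f\<bar> \<le> C * harm M"
proof (induction M)
  case 0
  then show ?case by (simp add: harm_def)
next
  case (Suc M)
  have int: "f integrable_on {a..b}" for a b
    by (intro integrable_continuous_real continuous_on_subset[OF cont]) auto
  have "integral {0..real M} f + integral {real M..real (Suc M)} f = integral {0..real (Suc M)} f"
    by (intro Henstock_Kurzweil_Integration.integral_combine int) auto
  moreover have "\<bar>f (real (Suc M)) - integral {real M..real (Suc M)} f\<bar> \<le> C / real (Suc M)"
  proof -
    have "((\<lambda>t. f (real (Suc M)) - f t) has_integral
        f (real (Suc M)) - integral {real M..real (Suc M)} f) {real M..real (Suc M)}"
      using has_integral_diff[OF has_integral_const_real[of "f (real (Suc M))" "real M" "real (Suc M)"]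
          integrable_integral[OF int]]
      by simp
    moreover have "0 \<le> C / real (Suc M)" using bd[of "real M" M] by force
    ultimately have "norm (f (real (Suc M)) - integral {real M..real (Suc M)} f)
        \<le> C / real (Suc M) * measure lborel {real M..real (Suc M)}"
      using bd[of _ M] by (intro has_integral_bound_real[where S = "{}"]) auto
    then show ?thesis by simp
  qed
  moreover have "C * harm (Suc M) = C * harm M + C / real (Suc M)"
    by (simp add: harm_Suc distrib_left divide_inverse)
  moreover have "(\<Sum>m=1..Suc M. f (real m)) = (\<Sum>m=1..M. f (real m)) + f (real (Suc M))"
    by simp
  ultimately show ?case using Suc by linarith
qed

text \<open>In the square of side \<open>N\<close>, the region below the line of slope
  \<open>a\<close> is a triangle if \<open>a \<le> 1\<close>; otherwise the line reaches height
  \<open>N\<close> at \<open>t = N / a\<close>, and the complement is a triangle.\<close>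

lemma has_integral_min_linear:
  fixes a N :: real
  assumes a: "0 \<le> a" and N: "0 \<le> N"
  shows "((\<lambda>t. min N (a * t)) has_integral N\<^sup>2 * (if a \<le> 1 then a / 2 else 1 - 1 / (2 * a))) {0..N}"
proof -
  have lin: "((\<lambda>t. min N (a * t)) has_integral a * c\<^sup>2 / 2) {0..c}" if c: "0 \<le> c" "a * c \<le> N" for c
  proof -
    have "((\<lambda>t. a * t) has_integral a * c\<^sup>2 / 2 - a * 0\<^sup>2 / 2) {0..c}"
      using c by (intro fundamental_theorem_of_calculus)
        (auto intro!: derivative_eq_intros simp flip: has_real_derivative_iff_has_vector_derivative)
    moreover have "a * t = min N (a * t)" if "t \<in> {0..c}" for t
      using that c a mult_left_mono[of t c a] by auto
    ultimately show ?thesis by (subst (asm) has_integral_cong) auto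
  qed
  show ?thesis
  proof (cases "a \<le> 1")
    case True
    then have "a * N \<le> N" using N by (simp add: mult_left_le_one_le a)
    from lin[OF N this] True show ?thesis by (simp add: mult.commute)
  next
    case False
    then have c: "0 \<le> N / a" "N / a \<le> N" "a * (N / a) \<le> N"
      using N mult_left_mono[of 1 a N] by (auto simp: field_simps)
    have "((\<lambda>t. N) has_integral N * (N - N / a)) {N / a..N}"
      using has_integral_const_real[of N "N / a" N] c by (simp add: mult.commute)
    moreover have "N = min N (a * t)" if "t \<in> {N / a..N}" for t
      using that False by (auto simp: field_simps)
    ultimately have "((\<lambda>t. min N (a * t)) has_integral N * (N - N / a)) {N / a..N}"
      by (subst (asm) has_integral_cong) auto
    from has_integral_combine[OF c(1,2) lin[OF c(1,3)] this] False
    show ?thesis by (simp add: power2_eq_square field_simps)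
  qed
qed

section \<open>Counting numerators for a fixed denominator\<close>

text \<open>For \<open>x = b ^ (i - 1) * n / m\<close>, the digit is the floor of
  \<open>b * x\<close> minus \<open>b\<close> times the floor of \<open>x\<close>, and the latter
  floor is that of \<open>b * x\<close> divided by \<open>b\<close>.\<close>

lemma base_digit_eq_mod:
  assumes "b \<ge> 1" "i \<ge> 1" "m \<ge> 1"
  shows "base_digit (real n / real m) b i = int (b ^ i * n div m mod b)"
proof -
  define x where "x = real b ^ (i - 1) * (real n / real m)"
  have bx: "real b * x = real (b ^ i * n) / real m"
    using assms by (cases i) (auto simp: x_def)
  have "real b * frac x = real b * x - of_int (int b * \<lfloor>x\<rfloor>)"
    by (simp add: frac_def algebra_simps)
  then have eq: "base_digit (real n / real m) b i = \<lfloor>real b * x\<rfloor> - int b * \<lfloor>x\<rfloor>"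
    unfolding base_digit_def x_def[symmetric] by (simp only: floor_diff_of_int)
  have "\<lfloor>x\<rfloor> = \<lfloor>real b * x\<rfloor> div int b"
    using assms floor_divide_real_eq_div[of "int b" "real b * x"] by simp
  then show ?thesis unfolding eq
    by (simp only: minus_mult_div_eq_mod bx floor_divide_of_nat_eq zmod_int)
qed

text \<open>The error has a fixed sign, so a difference of two such counts is still off by at most
  \<open>1\<close>.\<close>

lemma card_less_min:
  fixes c :: real
  assumes "0 \<le> c"
  shows "real (card {n \<in> {1..N::nat}. real n < c}) \<le> min (real N) c"
    and "min (real N) c \<le> real (card {n \<in> {1..N::nat}. real n < c}) + 1"
proof -
  \<comment> \<open>The inequality \<open>n < c\<close> is strict, hence ceiling minus one;
    \<open>nat\<close> turns \<open>-1\<close> into \<open>0\<close> when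
    \<open>c = 0\<close>.\<close>
  define j where "j = min N (nat (\<lceil>c\<rceil> - 1))"
  have "{n \<in> {1..N}. real n < c} = {1..j}"
    unfolding j_def by (auto simp: less_ceiling_iff le_nat_iff; linarith)
  then have card: "card {n \<in> {1..N}. real n < c} = j" by simp
  show "real (card {n \<in> {1..N::nat}. real n < c}) \<le> min (real N) c"
    "min (real N) c \<le> real (card {n \<in> {1..N::nat}. real n < c}) + 1"
    unfolding card j_def using assms by (auto simp: min_def; linarith)+
qed

text \<open>The \<open>n\<close> counted fill \<open>[c a, c (Suc a))\<close> with
  \<open>c a = a * m / Q\<close>. An interval starting beyond \<open>N\<close> contributes no error
  at all, which later makes the total error independent of \<open>K\<close>.\<close>

lemma card_div_eq_bound:
  fixes a m N Q :: nat
  assumes m: "m \<ge> 1" and Q: "Q \<ge> 1"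
  shows "\<bar>real (card {n \<in> {1..N}. Q * n div m = a}) -
     (min (real N) (real (Suc a) / real Q * real m) - min (real N) (real a / real Q * real m))\<bar>
     \<le> of_bool (real a \<le> real Q * real N / real m)"
proof -
  define c where "c a = real a / real Q * real m" for a
  define E where "E = (\<lambda>a. {n \<in> {1..N}. real n < c a})"
  have lt: "real n < c a \<longleftrightarrow> Q * n div m < a" for n a
  proof -
    have "real n < c a \<longleftrightarrow> real (Q * n) < real (a * m)"
      using Q by (simp add: c_def field_simps)
    also have "\<dots> \<longleftrightarrow> Q * n < a * m" by (simp only: of_nat_less_iff)
    finally show ?thesis using m by (simp add: div_less_iff_less_mult)
  qed
  have "{n \<in> {1..N}. Q * n div m = a} = E (Suc a) - E a"
    unfolding E_def lt by auto
  moreover have "E a \<subseteq> E (Suc a)" unfolding E_def lt by auto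
  moreover have "finite (E a)" for a by (simp add: E_def)
  ultimately have card: "real (card {n \<in> {1..N}. Q * n div m = a}) = real (card (E (Suc a))) - real (card (E a))"
    by (simp add: card_Diff_subset card_mono of_nat_diff)
  have c0: "0 \<le> c a" for a by (simp add: c_def)
  show ?thesis
  proof (cases "real a \<le> real Q * real N / real m")
    case True
    then show ?thesis
      unfolding card E_def c_def[symmetric]
      using card_less_min[OF c0, of N a] card_less_min[OF c0, of N "Suc a"]
      by (simp only: of_bool_eq)
  next
    case False
    then have "real N < c a" using m Q by (simp add: c_def field_simps)
    moreover have "c a \<le> c (Suc a)" by (simp add: c_def divide_right_mono mult_right_mono)
    ultimately have "E a = {1..N}" "E (Suc a) = {1..N}" "min (real N) (c (Suc a)) = real N"
      "min (real N) (c a) = real N"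
      by (auto simp: E_def)
    then show ?thesis unfolding card c_def[symmetric] by simp
  qed
qed

text \<open>Split by the quotient \<open>k\<close> of \<open>Q * n div m\<close> by
  \<open>b\<close>; \<open>K > Q * N\<close> covers all quotients. Only
  \<open>k \<le> Q * N / m\<close> can carry an error.\<close>

lemma card_mod_eq_bound:
  fixes b r m N Q K :: nat
  assumes b: "b \<ge> 1" and r: "r < b" and m: "m \<ge> 1" and Q: "Q \<ge> 1" and K: "Q * N < K"
  shows "\<bar>real (card {n \<in> {1..N}. Q * n div m mod b = r}) -
     (\<Sum>k<K. min (real N) (real (b * k + r + 1) / real Q * real m)
        - min (real N) (real (b * k + r) / real Q * real m))\<bar> \<le> real Q * real N / real m + 1"
proof -
  define A where "A = (\<lambda>k. {n \<in> {1..N}. Q * n div m = b * k + r})"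
  have "{n \<in> {1..N}. Q * n div m mod b = r} = (\<Union>k<K. A k)"
  proof (intro equalityI subsetI)
    fix n assume n: "n \<in> {n \<in> {1..N}. Q * n div m mod b = r}"
    define k where "k = Q * n div m div b"
    have "Q * n div m = b * k + r" using n by (auto simp: k_def)
    moreover have "k \<le> Q * n" unfolding k_def using div_le_dividend le_trans by blast
    moreover have "Q * n \<le> Q * N" using n by simp
    ultimately have "k < K" "n \<in> A k" using n K unfolding A_def by (linarith, blast)
    then show "n \<in> (\<Union>k<K. A k)" by blast
  qed (use r in \<open>auto simp: A_def\<close>)
  also have "card \<dots> = (\<Sum>k<K. card (A k))"
    using b by (intro card_UN_disjoint) (auto simp: A_def)
  finally have "\<bar>real (card {n \<in> {1..N}. Q * n div m mod b = r}) -
     (\<Sum>k<K. min (real N) (real (b * k + r + 1) / real Q * real m)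
        - min (real N) (real (b * k + r) / real Q * real m))\<bar>
     = \<bar>\<Sum>k<K. real (card (A k)) - (min (real N) (real (b * k + r + 1) / real Q * real m)
        - min (real N) (real (b * k + r) / real Q * real m))\<bar>"
    by (simp add: sum_subtractf)
  also have "\<dots> \<le> (\<Sum>k<K. of_bool (real (b * k + r) \<le> real Q * real N / real m))"
    using card_div_eq_bound[OF m Q, of N "b * _ + r"]
    by (intro sum_abs[THEN order_trans] sum_mono) (simp add: A_def)
  also have "\<dots> \<le> (\<Sum>k<K. of_bool (k \<le> nat \<lfloor>real Q * real N / real m\<rfloor>))"
  proof (rule sum_mono)
    fix k
    have "k \<le> b * k + r" using b by (cases b) auto
    then have "real k \<le> real (b * k + r)" by (simp only: of_nat_le_iff)
    then show "of_bool (real (b * k + r) \<le> real Q * real N / real m)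
        \<le> (of_bool (k \<le> nat \<lfloor>real Q * real N / real m\<rfloor>) :: real)"
      by (auto simp del: of_nat_add of_nat_mult intro!: le_nat_floor)
  qed
  also have "\<dots> = real (card ({..<K} \<inter> {k. k \<le> nat \<lfloor>real Q * real N / real m\<rfloor>}))"
    by (simp add: Int_def flip: sum.inter_filter)
  also have "\<dots> \<le> real (card {..nat \<lfloor>real Q * real N / real m\<rfloor>})"
    by (intro of_nat_mono card_mono) auto
  also have "\<dots> \<le> real Q * real N / real m + 1" by simp
  finally show ?thesis .
qed

section \<open>The area series and its value\<close>

text \<open>The logarithms cancel in the difference of the two limit formulas for
  \<open>Digamma\<close>.\<close>

lemma sum_inverse_diff_LIMSEQ:
  fixes b s :: nat
  assumes b: "b \<ge> 1" and s: "s \<ge> 1"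
  shows "(\<lambda>L. \<Sum>j<L. 1 / real (b * j + s) - 1 / real (b * j + s + 1))
    \<longlonglongrightarrow> (Digamma (real (s + 1) / real b) - Digamma (real s / real b)) / real b"
proof -
  have inv: "inverse (real u / real b + real j) / real b = 1 / real (b * j + u)" for u j
  proof -
    have "real u / real b + real j = real (b * j + u) / real b"
      using b by (simp add: add_divide_distrib)
    then show ?thesis using b by simp
  qed
  have "(\<lambda>L. ((of_real (ln (real L)) - (\<Sum>j<L. inverse (real (s + 1) / real b + of_nat j)))
      - (of_real (ln (real L)) - (\<Sum>j<L. inverse (real s / real b + of_nat j)))) / real b)
    \<longlonglongrightarrow> (Digamma (real (s + 1) / real b) - Digamma (real s / real b)) / real b"
    using b s by (intro tendsto_intros Digamma_LIMSEQ) auto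
  moreover have "((of_real (ln (real L)) - (\<Sum>j<L. inverse (real (s + 1) / real b + of_nat j)))
      - (of_real (ln (real L)) - (\<Sum>j<L. inverse (real s / real b + of_nat j)))) / real b
    = (\<Sum>j<L. inverse (real s / real b + real j) / real b)
      - (\<Sum>j<L. inverse (real (s + 1) / real b + real j) / real b)" for L
    by (simp add: diff_divide_distrib sum_divide_distrib)
  ultimately show ?thesis
    by (simp only: inv sum_subtractf add.assoc)
qed

text \<open>\<open>area a\<close> is the area of the part of the unit square with coordinates \<open>(t, x)\<close> below \<open>x = a t\<close>.\<close>

lemma area_sum_LIMSEQ:
  fixes b r i :: nat
  assumes b: "b \<ge> 2" and r: "r < b" and i: "i \<ge> 1"
  defines "area \<equiv> \<lambda>a::real. if a \<le> 1 then a / 2 else 1 - 1 / (2 * a)"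
  shows "(\<lambda>K. \<Sum>k<K. area (real (b * k + r + 1) / real (b ^ i)) - area (real (b * k + r) / real (b ^ i)))
    \<longlonglongrightarrow> digit_const b r i"
proof -
  define Q where "Q = b ^ i"
  define P where "P = b ^ (i - 1)"
  define s where "s = Q + r"
  define f where "f = (\<lambda>k. area (real (b * k + r + 1) / real Q) - area (real (b * k + r) / real Q))"
  have QP: "Q = b * P" using i by (cases i) (auto simp: Q_def P_def)
  have Q: "Q \<ge> 1" using b by (simp add: Q_def Suc_leI)
  \<comment> \<open>Both slopes are at most \<open>1\<close>. The \<open>P\<close> such terms add up
    to \<open>P / (2 * Q) = 1 / (2 * b)\<close>.\<close>
  have small: "f k = 1 / (2 * real Q)" if "k < P" for k
  proof -
    have "b * k + b \<le> b * P" using that by (metis Suc_leI mult_Suc_right add.commute mult_le_mono2)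
    then have "real (b * k + r + 1) \<le> real Q" unfolding of_nat_le_iff QP using r by linarith
    moreover have "real (b * k + r) \<le> real (b * k + r + 1)" by simp
    ultimately have "real (b * k + r + 1) / real Q \<le> 1" "real (b * k + r) / real Q \<le> 1"
      using Q by (auto simp: field_simps)
    then show ?thesis unfolding f_def area_def using Q by (simp add: field_simps)
  qed
  \<comment> \<open>The two formulas agree at \<open>a = 1\<close>, a slope that occurs for
    \<open>k = P\<close> when \<open>r = 0\<close>.\<close>
  have area_ge: "area a = 1 - 1 / (2 * a)" if "a \<ge> 1" for a
    using that by (cases "a = 1") (auto simp: area_def)
  have large: "f (P + j) = real Q / 2 * (1 / real (b * j + s) - 1 / real (b * j + s + 1))" for j
  proof -
    have eq: "b * (P + j) + r = b * j + s" by (simp add: s_def QP algebra_simps)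
    have "real (b * j + s) / real Q \<ge> 1" "real (b * j + s + 1) / real Q \<ge> 1"
      using Q by (simp_all add: s_def)
    then show ?thesis unfolding f_def eq by (simp only: area_ge) (simp add: algebra_simps)
  qed
  have split: "(\<Sum>k<L + P. f k) = 1 / (2 * real b) +
      real Q / 2 * (\<Sum>j<L. 1 / real (b * j + s) - 1 / real (b * j + s + 1))" for L
  proof (induction L)
    case 0
    have "P > 0" using b by (simp add: P_def)
    then show ?case using b by (simp add: small QP)
  next
    case (Suc L)
    then show ?case using large[of L] by (simp add: add.commute[of L] distrib_left)
  qed
  have "s \<ge> 1" using Q by (simp add: s_def)
  then have "(\<lambda>L. \<Sum>k<L + P. f k) \<longlonglongrightarrow> 1 / (2 * real b) +
      real Q / 2 * ((Digamma (real (s + 1) / real b) - Digamma (real s / real b)) / real b)"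
    unfolding split using b by (intro tendsto_intros sum_inverse_diff_LIMSEQ) auto
  \<comment> \<open>The same \<open>Digamma\<close> difference evaluates the integral in
    \<open>digit_const\<close>, whose exponent is \<open>s - 1\<close>.\<close>
  also have "1 / (2 * real b) +
      real Q / 2 * ((Digamma (real (s + 1) / real b) - Digamma (real s / real b)) / real b) = digit_const b r i"
    using integral_unique[OF has_integral_digit_const[OF b \<open>s \<ge> 1\<close>]]
    by (simp add: digit_const_def s_def Q_def)
  finally show ?thesis
    unfolding f_def Q_def by (rule LIMSEQ_offset)
qed

section \<open>Summation over denominators and the asymptotics\<close>

text \<open>Counting costs \<open>Q * N * harm N + N\<close>, and passing to the integral costs
  \<open>2 * N * harm N\<close>.\<close>

lemma card_mod_pairs_bound:
  fixes b r i N :: nat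
  assumes b: "b \<ge> 2" and r: "r < b" and i: "i \<ge> 1"
  shows "\<bar>real (\<Sum>m=1..N. card {n \<in> {1..N}. b ^ i * n div m mod b = r}) - digit_const b r i * (real N)\<^sup>2\<bar>
    \<le> (real (b ^ i) + 2) * real N * harm N + real N"
proof -
  define Q where "Q = b ^ i"
  define \<alpha> where "\<alpha> = (\<lambda>k. real (b * k + r) / real Q)"
  define \<beta> where "\<beta> = (\<lambda>k. real (b * k + r + 1) / real Q)"
  define area where "area = (\<lambda>a::real. if a \<le> 1 then a / 2 else 1 - 1 / (2 * a))"
  define \<Phi> where "\<Phi> = real (\<Sum>m=1..N. card {n \<in> {1..N}. Q * n div m mod b = r})"
  define h where "h = (\<lambda>K t. \<Sum>k<K. min (real N) (\<beta> k * t) - min (real N) (\<alpha> k * t))"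
  have Q: "Q \<ge> 1" using b by (simp add: Q_def Suc_leI)
  have ab: "\<alpha> k \<le> \<beta> k" and a0: "0 \<le> \<alpha> k" and b0: "0 \<le> \<beta> k" for k
    by (simp_all add: \<alpha>_def \<beta>_def divide_right_mono)
  have ba: "\<beta> k \<le> \<alpha> (Suc k)" for k
  proof -
    have "real (b * k + r + 1) \<le> real (b * Suc k + r)" unfolding of_nat_le_iff using b by simp
    then show ?thesis unfolding \<alpha>_def \<beta>_def by (rule divide_right_mono) simp
  qed
  have bound: "\<bar>\<Phi> - (real N)\<^sup>2 * (\<Sum>k<K. area (\<beta> k) - area (\<alpha> k))\<bar>
      \<le> (real Q + 2) * real N * harm N + real N" if K: "Q * N < K" for K
  proof -
    have "\<Phi> - (\<Sum>m=1..N. h K (real m))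
        = (\<Sum>m=1..N. real (card {n \<in> {1..N}. Q * n div m mod b = r}) - h K (real m))"
      by (simp add: \<Phi>_def sum_subtractf)
    also have "\<bar>\<dots>\<bar> \<le> (\<Sum>m=1..N. real Q * real N / real m + 1)"
      using b r Q K unfolding h_def \<alpha>_def \<beta>_def
      by (intro sum_abs[THEN order_trans] sum_mono card_mod_eq_bound) auto
    also have "\<dots> = real Q * real N * harm N + real N"
      by (simp add: sum.distrib harm_def sum_distrib_left divide_inverse)
    finally have 1: "\<bar>\<Phi> - (\<Sum>m=1..N. h K (real m))\<bar> \<le> real Q * real N * harm N + real N" .
    have 2: "\<bar>(\<Sum>m=1..N. h K (real m)) - integral {0..real N} (h K)\<bar> \<le> 2 * real N * harm N"
    proof (rule sum_integral_harm_bound)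
      show "continuous_on UNIV (h K)" unfolding h_def by (intro continuous_intros)
    next
      fix m t assume t: "t \<in> {real m..real (Suc m)}"
      have "\<bar>h K (real (Suc m)) - h K t\<bar> \<le> 2 * real N / real (Suc m) * (real (Suc m) - t)"
        unfolding h_def using t by (intro sum_min_scaled_diff_bound ab ba a0) auto
      also have "\<dots> \<le> 2 * real N / real (Suc m) * 1"
        using t by (intro mult_left_mono) auto
      finally show "\<bar>h K (real (Suc m)) - h K t\<bar> \<le> 2 * real N / real (Suc m)" by simp
    qed
    have "(h K has_integral (\<Sum>k<K. (real N)\<^sup>2 * area (\<beta> k) - (real N)\<^sup>2 * area (\<alpha> k))) {0..real N}"
      unfolding h_def area_def
      by (intro has_integral_sum has_integral_diff has_integral_min_linear a0 b0) auto
    then have 3: "integral {0..real N} (h K) = (real N)\<^sup>2 * (\<Sum>k<K. area (\<beta> k) - area (\<alpha> k))"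
      by (simp add: integral_unique sum_distrib_left right_diff_distrib)
    show ?thesis using 1 2 unfolding 3 by (simp add: algebra_simps)
  qed
  \<comment> \<open>The right side of \<open>bound\<close> is free of \<open>K\<close>, so it
    survives the limit.\<close>
  have "(\<lambda>K. \<bar>\<Phi> - (real N)\<^sup>2 * (\<Sum>k<K. area (\<beta> k) - area (\<alpha> k))\<bar>)
      \<longlonglongrightarrow> \<bar>\<Phi> - (real N)\<^sup>2 * digit_const b r i\<bar>"
    unfolding \<alpha>_def \<beta>_def area_def Q_def
    by (intro tendsto_intros area_sum_LIMSEQ b r i)
  then have "\<bar>\<Phi> - (real N)\<^sup>2 * digit_const b r i\<bar> \<le> (real Q + 2) * real N * harm N + real N"
    by (rule tendsto_upperbound)
      (auto intro!: eventually_mono[OF eventually_gt_at_top[of "Q * N"]] bound)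
  then show ?thesis unfolding \<Phi>_def Q_def by (simp add: mult.commute)
qed

lemma harm_le_ln: "harm n \<le> 1 + ln (real n)" if "n \<ge> 1"
proof -
  have "harm (Suc k) \<le> 1 + ln (real (Suc k))" for k
    using decseqD[OF decseq_harm_diff_ln, of 0 k] by (simp add: harm_def)
  from this[of "n - 1"] that show ?thesis by simp
qed

lemma digit_count_eq_sum:
  assumes b: "b \<ge> 1" and i: "i \<ge> 1"
  shows "digit_count T b r i =
    (\<Sum>m=1..nat \<lfloor>T\<rfloor>. card {n \<in> {1..nat \<lfloor>T\<rfloor>}. b ^ i * n div m mod b = r})"
proof -
  define N where "N = nat \<lfloor>T\<rfloor>"
  have N: "1 \<le> real n \<and> real n \<le> T \<longleftrightarrow> n \<in> {1..N}" for n
    unfolding N_def by (cases "n = 0") (auto simp: le_nat_floor, linarith)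
  have "digit_pairs T b r i = (\<lambda>(m, n). (n, m)) `
      (SIGMA m:{1..N}. {n \<in> {1..N}. b ^ i * n div m mod b = r})"
    unfolding digit_pairs_def using N base_digit_eq_mod[OF b i]
    by (fastforce simp: image_iff)
  moreover have "inj_on (\<lambda>(m, n). (n, m)) X" for X :: "(nat \<times> nat) set"
    by (auto simp: inj_on_def)
  ultimately show ?thesis
    unfolding digit_count_def N_def by (simp add: card_image)
qed

theorem theorem2p1:
  fixes b r i :: nat
  assumes "b \<ge> 2" and "r \<in> {0..b - 1}" and "i \<ge> 1"
  shows "(\<lambda>T::real. real (digit_count T b r i) - digit_const b r i * T\<^sup>2)
           \<in> O[at_top](\<lambda>T. T * ln T)"
proof -
  have b: "b \<ge> 2" and r: "r < b" and i: "i \<ge> 1" using assms by auto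
  define c where "c = digit_const b r i"
  define C where "C = real (b ^ i) + 2"
  have bound: "\<bar>real (digit_count T b r i) - c * T\<^sup>2\<bar> \<le> C * T * (1 + ln T) + T + \<bar>c\<bar> * (2 * T)"
    if T: "T \<ge> 1" for T
  proof -
    define N where "N = nat \<lfloor>T\<rfloor>"
    have N: "N \<ge> 1" "real N \<le> T" "T \<le> real N + 1"
      using T by (auto simp: N_def le_nat_iff le_floor_iff)
    have "harm N \<le> 1 + ln (real N)" using N by (intro harm_le_ln)
    also have "\<dots> \<le> 1 + ln T" using N by simp
    finally have harm: "harm N \<le> 1 + ln T" .
    have "\<bar>real (digit_count T b r i) - c * (real N)\<^sup>2\<bar> \<le> C * real N * harm N + real N"
      using card_mod_pairs_bound[OF b r i, of N] b i
      by (simp only: digit_count_eq_sum c_def C_def N_def)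
    also have "\<dots> \<le> C * T * (1 + ln T) + T"
      using N harm T by (intro add_mono mult_mono) (auto simp: C_def intro: harm_nonneg)
    finally have 1: "\<bar>real (digit_count T b r i) - c * (real N)\<^sup>2\<bar> \<le> C * T * (1 + ln T) + T" .
    \<comment> \<open>Replacing \<open>N\<close> by \<open>T\<close> in the main term costs only
      \<open>O(T)\<close>.\<close>
    have "T\<^sup>2 - (real N)\<^sup>2 = (T - real N) * (T + real N)"
      by (simp add: power2_eq_square algebra_simps)
    also have "\<dots> \<le> 1 * (2 * T)" using N T by (intro mult_mono) auto
    finally have "\<bar>T\<^sup>2 - (real N)\<^sup>2\<bar> \<le> 2 * T" using N T by (simp add: power_mono)
    then have "\<bar>c * (real N)\<^sup>2 - c * T\<^sup>2\<bar> \<le> \<bar>c\<bar> * (2 * T)"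
      by (simp add: abs_mult abs_minus_commute mult_left_mono flip: right_diff_distrib)
    with 1 show ?thesis by linarith
  qed
  show ?thesis
  proof (rule bigoI)
    show "eventually (\<lambda>T. norm (real (digit_count T b r i) - digit_const b r i * T\<^sup>2)
        \<le> (2 * C + 1 + 2 * \<bar>c\<bar>) * norm (T * ln T)) at_top"
      \<comment> \<open>From \<open>T \<ge> exp 1\<close> on, \<open>ln T \<ge> 1\<close>, so
        \<open>1 + ln T \<le> 2 * ln T\<close> and \<open>T \<le> T * ln T\<close>; this gives the
        constant.\<close>
      using eventually_ge_at_top[of "exp 1 :: real"]
    proof eventually_elim
      case (elim T)
      have T: "T \<ge> 1" using elim exp_ge_add_one_self[of 1] by linarith
      have ln: "ln T \<ge> 1" using elim T by (simp add: ln_ge_iff)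
      have le: "T \<le> T * ln T" using mult_left_mono[OF ln, of T] T by simp
      have "C * T * (1 + ln T) \<le> C * T * (2 * ln T)"
        using T ln by (intro mult_left_mono) (auto simp: C_def)
      moreover have "\<bar>c\<bar> * (2 * T) \<le> \<bar>c\<bar> * (2 * (T * ln T))"
        using le by (intro mult_left_mono) auto
      moreover have "norm (T * ln T) = T * ln T" using T ln by (simp add: abs_mult)
      ultimately show ?case using bound[OF T] le
        unfolding c_def[symmetric] by (simp add: algebra_simps)
    qed
  qed
qed

end
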